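(* Let $f\in\mathcal{SR}(\Omega)$ with $\Omega=\Omega_D$ and let $y\in\Omega$. - The zero set $V(f)$ includes $y$ if, and only if, $x-y\,|\,f(x)$. If this is the case, then $x^2-x\,t(y)+n(y)\,|\,N(f)(x)$. If $y\in\Omega\setminus\mathbb{R}$ then: - $V(f)\supseteq T_{y_1}$ if, and only if, $x-y\,|\,f(x)$ and $x_1^2-x_1t(y)+n(y)\,|\,{}^{\pi}\!f(x_1)$; - $V(f)\supseteq\mathbb{S}_y$ if, and only if, $x^2-x\,t(y)+n(y)\,|\,f(x)$.
   Context: $\mathbb{H}$ is the algebra of quaternions, with conjugation $q\mapsto q^c$; $\mathrm{Im}(\mathbb{H})$ is the space of purely imaginary quaternions; $p\perp q$ means $pq^c+qp^c=0$. The dual quaternions are $\mathbb{DH}=\mathbb{H}+\epsilon\mathbb{H}$, with elements $h=h_1+\epsilon h_2$, componentwise addition and product $hh'=h_1h'_1+\epsilon(h_1h'_2+h_2h'_1)$; $\pi(h)=h_1$ is the primal part (a subscript $1$ denotes the primal part). Put $h^c=h_1^c+\epsilon h_2^c$, $t(h)=h+h^c$, $n(h)=hh^c$. For $A=\mathbb{H}$ or $\mathbb{DH}$ let $\mathbb{S}_A=\{J\in A: t(J)=0,\ n(J)=1\}$. Let $Q_{\mathbb{DH}}=\{\alpha+\beta J:\alpha,\beta\in\mathbb{R},\ J\in\mathbb{S}_{\mathbb{DH}}\}$. For $x=\alpha+\beta J\in Q_{\mathbb{DH}}$ put $\mathbb{S}_x=\alpha+\beta\,\mathbb{S}_{\mathbb{DH}}$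 and, if $x\notin\mathbb{R}$, $T_{x_1}=\{x_1+\epsilon\gamma:\gamma\in\mathrm{Im}(\mathbb{H}),\ \gamma\perp\mathrm{Im}(x_1)\}\subset\mathbb{S}_x$. $D\subseteq\mathbb{C}$ is open and invariant under complex conjugation, and $\Omega=\Omega_D=\{\alpha+\beta J:\alpha,\beta\in\mathbb{R},\ \alpha+i\beta\in D,\ J\in\mathbb{S}_{\mathbb{DH}}\}$. For $A=\mathbb{H}$ or $\mathbb{DH}$, let $A_{\mathbb{C}}=A\otimes_{\mathbb{R}}\mathbb{C}=\{a+\iota b: a,b\in A\}$, $\iota^2=-1$, $\iota$ central, $(a+\iota b)^c=a^c+\iota b^c$. A stem function is $F=F_1+\iota F_2:D\to A_{\mathbb{C}}$ with $F_1(\bar z)=F_1(z)$, $F_2(\bar z)=-F_2(z)$; it induces the slice function $f=\mathcal{I}(F)$, $f(\alpha+\beta J)=F_1(\alpha+i\beta)+JF_2(\alpha+i\beta)$ for $J\in\mathbb{S}_A$, defined on $\Omega$ if $A=\mathbb{DH}$ and on $\Omega\cap\mathbb{H}$ if $A=\mathbb{H}$. $\mathcal{S}(\Omega)$ and $\mathcal{S}(\Omega\cap\mathbb{H})$ denote the corresponding sets of $\mathbb{DH}$-valued, resp. $\mathbb{H}$-valued, slice functions. Put $\mathcal{I}(F)\cdot\mathcal{I}(G)=\mathcal{I}(FG)$ (pointwise product of stem functions), $\mathcal{I}(F)^c=\mathcal{I}(F^c)$ with $F^c(z)=F(z)^c$, $N(f)=f\cdot f^c$. $f=\mathcal{I}(F)$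 is slice regular if $F$ is of class $C^1$ and $\frac{\partial F}{\partial\alpha}+\iota\frac{\partial F}{\partial\beta}=0$; $\mathcal{SR}(\Omega)$ is the set of slice regular functions $\Omega\to\mathbb{DH}$. The primal part of $f=\mathcal{I}(F_1+\iota F_2):\Omega\to\mathbb{DH}$ is ${}^{\pi}\!f=\mathcal{I}(\pi\circ F_1+\iota\,\pi\circ F_2)\in\mathcal{S}(\Omega\cap\mathbb{H})$. $V(f)=\{x\in\Omega: f(x)=0\}$. For $f,h\in\mathcal{S}(\Omega)$, $h(x)\,|\,f(x)$ ($h$ divides $f$ on the left) means that there is $g\in\mathcal{S}(\Omega)$ with $f=h\cdot g$ in $\Omega$; divisibility among functions of the quaternionic variable $x_1$ is defined in the same way in $\mathcal{S}(\Omega\cap\mathbb{H})$. Polynomial expressions in $x$ with coefficients on the right, such as $x-y$, are regarded as slice functions. *)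

theory Defs
  imports "HOL-Analysis.Analysis"
begin

section \<open>Real algebras with an antiinvolution\<close>

class star_algebra = real_algebra_1 +
  fixes star :: "'a \<Rightarrow> 'a"
  assumes star_star [simp]: "star (star x) = x"
    and star_add: "star (x + y) = star x + star y"
    and star_mult: "star (x * y) = star y * star x"
    and star_scaleR: "star (r *\<^sub>R x) = r *\<^sub>R star x"

definition tr :: "'a::star_algebra \<Rightarrow> 'a" where
  "tr h = h + star h"

definition nm :: "'a::star_algebra \<Rightarrow> 'a" where
  "nm h = h * star h"

definition unit_sphere :: "'a::star_algebra set" where
  "unit_sphere = {J. tr J = 0 \<and> nm J = 1}"


section \<open>Quaternions\<close>

datatype quat = Quat (qre: real) (qi: real) (qj: real) (qk: real)

instantiation quat :: star_algebra
begin

definition "0 = Quat 0 0 0 0"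
definition "1 = Quat 1 0 0 0"
definition "p + q = Quat (qre p + qre q) (qi p + qi q) (qj p + qj q) (qk p + qk q)"
definition "p - q = Quat (qre p - qre q) (qi p - qi q) (qj p - qj q) (qk p - qk q)"
definition "- q = Quat (- qre q) (- qi q) (- qj q) (- qk q)"
definition "r *\<^sub>R q = Quat (r * qre q) (r * qi q) (r * qj q) (r * qk q)"
definition "p * q = Quat
  (qre p * qre q - qi p * qi q - qj p * qj q - qk p * qk q)
  (qre p * qi q + qi p * qre q + qj p * qk q - qk p * qj q)
  (qre p * qj q - qi p * qk q + qj p * qre q + qk p * qi q)
  (qre p * qk q + qi p * qj q - qj p * qi q + qk p * qre q)"
definition "star q = Quat (qre q) (- qi q) (- qj q) (- qk q)"

lemmas quat_ops_defs = zero_quat_def one_quat_def plus_quat_def minus_quat_def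
  uminus_quat_def scaleR_quat_def times_quat_def star_quat_def

instance
  by standard (simp_all add: quat_ops_defs algebra_simps)

end

instantiation quat :: real_normed_vector
begin

definition "norm q = sqrt ((qre q)\<^sup>2 + (qi q)\<^sup>2 + (qj q)\<^sup>2 + (qk q)\<^sup>2)"
definition "sgn (q::quat) = inverse (norm q) *\<^sub>R q"
definition "dist (p::quat) q = norm (p - q)"
definition [code del]:
  "(uniformity :: (quat \<times> quat) filter) = (INF e\<in>{0<..}. principal {(x, y). dist x y < e})"
definition [code del]:
  "open (U :: quat set) \<longleftrightarrow> (\<forall>x\<in>U. eventually (\<lambda>(x', y). x' = x \<longrightarrow> y \<in> U) uniformity)"

lemma norm_quat_eq_norm_prod: "norm q = norm ((qre q, qi q), (qj q, qk q))"
  by (simp add: norm_quat_def norm_prod_def add.assoc)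

instance
proof
  fix p q :: quat and r :: real
  show "norm q = 0 \<longleftrightarrow> q = 0"
    by (cases q) (simp add: norm_quat_eq_norm_prod zero_quat_def zero_prod_def)
  show "norm (p + q) \<le> norm p + norm q"
    unfolding norm_quat_eq_norm_prod
    using norm_triangle_ineq[of "((qre p, qi p), (qj p, qk p))" "((qre q, qi q), (qj q, qk q))"]
    by (simp add: plus_quat_def)
  show "norm (r *\<^sub>R q) = \<bar>r\<bar> * norm q"
    unfolding norm_quat_eq_norm_prod
    using norm_scaleR[of r "((qre q, qi q), (qj q, qk q))"]
    by (simp add: scaleR_quat_def)
qed (rule sgn_quat_def dist_quat_def uniformity_quat_def open_quat_def)+

end

definition imag_quats :: "quat set" where
  "imag_quats = {q. qre q = 0}"

definition quat_imag :: "quat \<Rightarrow> quat" where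
  "quat_imag q = Quat 0 (qi q) (qj q) (qk q)"

definition quat_perp :: "quat \<Rightarrow> quat \<Rightarrow> bool" where
  "quat_perp p q \<longleftrightarrow> p * star q + q * star p = 0"


section \<open>Dual numbers over an algebra; dual quaternions\<close>

text \<open>\<open>Dual a b\<close> stands for $a + \epsilon b$ with $\epsilon$ central and $\epsilon^2 = 0$.\<close>

datatype 'a dual_number = Dual (primal: 'a) (eps_part: 'a)

type_synonym dual_quat = "quat dual_number"

instantiation dual_number :: (real_vector) real_vector
begin

definition "0 = Dual 0 0"
definition "x + y = Dual (primal x + primal y) (eps_part x + eps_part y)"
definition "x - y = Dual (primal x - primal y) (eps_part x - eps_part y)"
definition "- x = Dual (- primal x) (- eps_part x)"
definition "r *\<^sub>R x = Dual (r *\<^sub>R primal x) (r *\<^sub>R eps_part x)"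

lemmas dual_vector_defs = zero_dual_number_def plus_dual_number_def minus_dual_number_def
  uminus_dual_number_def scaleR_dual_number_def

instance
  by standard (simp_all add: dual_vector_defs algebra_simps)

end

instantiation dual_number :: (star_algebra) star_algebra
begin

definition "1 = Dual 1 0"
definition "x * y = Dual (primal x * primal y) (primal x * eps_part y + eps_part x * primal y)"
definition "star x = Dual (star (primal x)) (star (eps_part x))"

lemmas dual_ops_defs = dual_vector_defs one_dual_number_def times_dual_number_def star_dual_number_def

instance
  by standard (simp_all add: dual_ops_defs algebra_simps star_add star_mult star_scaleR)

end

instantiation dual_number :: (real_normed_vector) real_normed_vector
begin

definition "norm x = norm (primal x, eps_part x)"
definition "sgn (x::'a dual_number) = inverse (norm x) *\<^sub>R x"
definition "dist (x::'a dual_number) y = norm (x - y)"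
definition [code del]:
  "(uniformity :: ('a dual_number \<times> 'a dual_number) filter) =
    (INF e\<in>{0<..}. principal {(x, y). dist x y < e})"
definition [code del]:
  "open (U :: 'a dual_number set) \<longleftrightarrow>
    (\<forall>x\<in>U. eventually (\<lambda>(x', y). x' = x \<longrightarrow> y \<in> U) uniformity)"

instance
proof
  fix x y :: "'a dual_number" and r :: real
  show "norm x = 0 \<longleftrightarrow> x = 0"
    by (cases x) (simp add: norm_dual_number_def zero_dual_number_def zero_prod_def)
  show "norm (x + y) \<le> norm x + norm y"
    using norm_triangle_ineq[of "(primal x, eps_part x)" "(primal y, eps_part y)"]
    by (simp add: norm_dual_number_def plus_dual_number_def)
  show "norm (r *\<^sub>R x) = \<bar>r\<bar> * norm x"
    using norm_scaleR[of r "(primal x, eps_part x)"]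
    by (simp add: norm_dual_number_def scaleR_dual_number_def)
qed (rule sgn_dual_number_def dist_dual_number_def uniformity_dual_number_def open_dual_number_def)+

end


section \<open>Complexification of an algebra\<close>

text \<open>\<open>Cplx a b\<close> stands for $a + \iota b$ with $\iota$ central, $\iota^2 = -1$ and
  $\iota$ fixed by the antiinvolution.\<close>

datatype 'a complexified = Cplx (part1: 'a) (part2: 'a)

instantiation complexified :: (real_vector) real_vector
begin

definition "0 = Cplx 0 0"
definition "x + y = Cplx (part1 x + part1 y) (part2 x + part2 y)"
definition "x - y = Cplx (part1 x - part1 y) (part2 x - part2 y)"
definition "- x = Cplx (- part1 x) (- part2 x)"
definition "r *\<^sub>R x = Cplx (r *\<^sub>R part1 x) (r *\<^sub>R part2 x)"

lemmas complexified_vector_defs = zero_complexified_def plus_complexified_def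
  minus_complexified_def uminus_complexified_def scaleR_complexified_def

instance
  by standard (simp_all add: complexified_vector_defs algebra_simps)

end

instantiation complexified :: (star_algebra) star_algebra
begin

definition "1 = Cplx 1 0"
definition "x * y = Cplx (part1 x * part1 y - part2 x * part2 y)
                         (part1 x * part2 y + part2 x * part1 y)"
definition "star x = Cplx (star (part1 x)) (star (part2 x))"

lemmas complexified_ops_defs = complexified_vector_defs one_complexified_def
  times_complexified_def star_complexified_def

lemma star_diff: "star (a - b) = star a - star (b::'b::star_algebra)"
  by (metis add_diff_cancel diff_add_cancel star_add)

instance
  by standard
    (simp_all add: complexified_ops_defs algebra_simps star_add star_diff star_mult star_scaleR)

end

instantiation complexified :: (real_normed_vector) real_normed_vector
begin

definition "norm x = norm (part1 x, part2 x)"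
definition "sgn (x::'a complexified) = inverse (norm x) *\<^sub>R x"
definition "dist (x::'a complexified) y = norm (x - y)"
definition [code del]:
  "(uniformity :: ('a complexified \<times> 'a complexified) filter) =
    (INF e\<in>{0<..}. principal {(x, y). dist x y < e})"
definition [code del]:
  "open (U :: 'a complexified set) \<longleftrightarrow>
    (\<forall>x\<in>U. eventually (\<lambda>(x', y). x' = x \<longrightarrow> y \<in> U) uniformity)"

instance
proof
  fix x y :: "'a complexified" and r :: real
  show "norm x = 0 \<longleftrightarrow> x = 0"
    by (cases x) (simp add: norm_complexified_def zero_complexified_def zero_prod_def)
  show "norm (x + y) \<le> norm x + norm y"
    using norm_triangle_ineq[of "(part1 x, part2 x)" "(part1 y, part2 y)"]
    by (simp add: norm_complexified_def plus_complexified_def)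
  show "norm (r *\<^sub>R x) = \<bar>r\<bar> * norm x"
    using norm_scaleR[of r "(part1 x, part2 x)"]
    by (simp add: norm_complexified_def scaleR_complexified_def)
qed (rule sgn_complexified_def dist_complexified_def uniformity_complexified_def
    open_complexified_def)+

end

definition iota :: "'a::star_algebra complexified" where
  "iota = Cplx 0 1"


section \<open>Slice functions\<close>

text \<open>At the type \<^typ>\<open>dual_quat\<close> this is $\Omega_D$; at the type \<^typ>\<open>quat\<close> it is
  $\Omega_D \cap \mathbb{H}$, as the lemma \<open>Omega_quat_iff\<close> below shows.\<close>

definition Omega :: "complex set \<Rightarrow> 'a::star_algebra set" where
  "Omega D = {of_real \<alpha> + \<beta> *\<^sub>R J | \<alpha> \<beta> J. Complex \<alpha> \<beta> \<in> D \<and> J \<in> unit_sphere}"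

definition stem_function :: "complex set \<Rightarrow> (complex \<Rightarrow> 'a::star_algebra complexified) \<Rightarrow> bool" where
  "stem_function D F \<longleftrightarrow>
    (\<forall>z\<in>D. part1 (F (cnj z)) = part1 (F z) \<and> part2 (F (cnj z)) = - part2 (F z))"

text \<open>Functions on \<^term>\<open>Omega D\<close> are total functions considered on \<^term>\<open>Omega D\<close> only.
  For a stem function the induced value does not depend on the representation
  $x = \alpha + \beta J$ (lemma \<open>slice_fun_eq\<close>), and a slice function determines its stem function
  on \<^term>\<open>D\<close> (lemma \<open>stem_function_unique\<close>), so that the description operators are harmless.\<close>

definition slice_fun ::
  "complex set \<Rightarrow> (complex \<Rightarrow> 'a::star_algebra complexified) \<Rightarrow> 'a \<Rightarrow> 'a" where
  "slice_fun D F x = (THE w. \<exists>\<alpha> \<beta> J. Complex \<alpha> \<beta> \<in> D \<and> J \<in> unit_sphere \<and>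
      x = of_real \<alpha> + \<beta> *\<^sub>R J \<and> w = part1 (F (Complex \<alpha> \<beta>)) + J * part2 (F (Complex \<alpha> \<beta>)))"

definition induced_by ::
  "complex set \<Rightarrow> ('a::star_algebra \<Rightarrow> 'a) \<Rightarrow> (complex \<Rightarrow> 'a complexified) \<Rightarrow> bool" where
  "induced_by D f F \<longleftrightarrow> stem_function D F \<and> (\<forall>x\<in>Omega D. f x = slice_fun D F x)"

definition slice_functions :: "complex set \<Rightarrow> ('a::star_algebra \<Rightarrow> 'a) set" where
  "slice_functions D = {f. \<exists>F. induced_by D f F}"

definition stem_of ::
  "complex set \<Rightarrow> ('a::star_algebra \<Rightarrow> 'a) \<Rightarrow> complex \<Rightarrow> 'a complexified" where
  "stem_of D f = (SOME F. induced_by D f F)"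

definition slice_mult ::
  "complex set \<Rightarrow> ('a::star_algebra \<Rightarrow> 'a) \<Rightarrow> ('a \<Rightarrow> 'a) \<Rightarrow> 'a \<Rightarrow> 'a" where
  "slice_mult D f g = slice_fun D (\<lambda>z. stem_of D f z * stem_of D g z)"

definition slice_conj :: "complex set \<Rightarrow> ('a::star_algebra \<Rightarrow> 'a) \<Rightarrow> 'a \<Rightarrow> 'a" where
  "slice_conj D f = slice_fun D (\<lambda>z. star (stem_of D f z))"

definition slice_norm :: "complex set \<Rightarrow> ('a::star_algebra \<Rightarrow> 'a) \<Rightarrow> 'a \<Rightarrow> 'a" where
  "slice_norm D f = slice_mult D f (slice_conj D f)"

text \<open>Left divisibility; the cofactor \<open>g\<close> need only be slice, not slice regular.\<close>

definition slice_dvd :: "complex set \<Rightarrow> ('a::star_algebra \<Rightarrow> 'a) \<Rightarrow> ('a \<Rightarrow> 'a) \<Rightarrow> bool" where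
  "slice_dvd D h f \<longleftrightarrow> (\<exists>g\<in>slice_functions D. \<forall>x\<in>Omega D. f x = slice_mult D h g x)"

text \<open>The primal part is a function of a quaternionic variable. Polynomials in that variable whose
  coefficients are $t(y)$ and $n(y)$, which are real for \<open>y\<close> in \<^term>\<open>Omega D\<close>, are written
  with \<^term>\<open>primal (tr y)\<close> and \<^term>\<open>primal (nm y)\<close>.\<close>

definition slice_primal :: "complex set \<Rightarrow> (dual_quat \<Rightarrow> dual_quat) \<Rightarrow> quat \<Rightarrow> quat" where
  "slice_primal D f =
    slice_fun D (\<lambda>z. Cplx (primal (part1 (stem_of D f z))) (primal (part2 (stem_of D f z))))"

definition C1_on :: "(complex \<Rightarrow> 'a::real_normed_vector) \<Rightarrow> complex set \<Rightarrow> bool" where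
  "C1_on F D \<longleftrightarrow> (\<exists>F' :: complex \<Rightarrow> complex \<Rightarrow>\<^sub>L 'a.
    (\<forall>z\<in>D. (F has_derivative blinfun_apply (F' z)) (at z)) \<and> continuous_on D F')"

text \<open>The values of the Frechet derivative at \<open>1\<close> and \<open>\<i>\<close> are the partial derivatives with
  respect to $\alpha$ and $\beta$.\<close>

definition slice_regular :: "complex set \<Rightarrow> (dual_quat \<Rightarrow> dual_quat) set" where
  "slice_regular D = {f. \<exists>F. induced_by D f F \<and> C1_on F D \<and>
    (\<forall>z\<in>D. frechet_derivative F (at z) 1 + iota * frechet_derivative F (at z) \<i> = 0)}"

definition zero_set :: "complex set \<Rightarrow> (dual_quat \<Rightarrow> dual_quat) \<Rightarrow> dual_quat set" where
  "zero_set D f = {x \<in> Omega D. f x = 0}"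

definition sphere_of :: "dual_quat \<Rightarrow> dual_quat set" where
  "sphere_of x = {of_real \<alpha> + \<beta> *\<^sub>R K | \<alpha> \<beta> J K.
     J \<in> unit_sphere \<and> x = of_real \<alpha> + \<beta> *\<^sub>R J \<and> K \<in> unit_sphere}"

definition T_set :: "quat \<Rightarrow> dual_quat set" where
  "T_set q = {Dual q \<gamma> | \<gamma>. \<gamma> \<in> imag_quats \<and> quat_perp \<gamma> (quat_imag q)}"


section \<open>Well-definedness\<close>

lemma unit_sphere_star: "J \<in> unit_sphere \<Longrightarrow> star J = - J"
  by (simp add: unit_sphere_def tr_def eq_neg_iff_add_eq_0 add.commute)

lemma unit_sphere_square: "J \<in> unit_sphere \<Longrightarrow> J * J = -1"
proof -
  assume J: "J \<in> unit_sphere"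
  then have "J * star J = 1"
    by (simp add: unit_sphere_def nm_def)
  then have "- (J * J) = 1"
    using unit_sphere_star[OF J] by simp
  then show ?thesis by (metis minus_minus)
qed

lemma unit_sphere_uminus: "J \<in> unit_sphere \<Longrightarrow> - J \<in> unit_sphere"
proof -
  assume J: "J \<in> unit_sphere"
  have "star (- J) = J" "J * J = -1"
    using star_scaleR[of "-1" J] unit_sphere_star[OF J] unit_sphere_square[OF J] by simp_all
  then show ?thesis by (simp add: unit_sphere_def tr_def nm_def)
qed

lemma star_one [simp]: "star (1::'a::star_algebra) = 1"
  by (metis mult_1_left mult_1_right star_mult star_star)

lemma star_of_real [simp]: "star (of_real r :: 'a::star_algebra) = of_real r"
  by (simp add: of_real_def star_scaleR)

lemma sphere_representation_unique:
  fixes J K :: "'a::star_algebra"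
  assumes J: "J \<in> unit_sphere" and K: "K \<in> unit_sphere"
    and eq: "of_real \<alpha> + \<beta> *\<^sub>R J = of_real \<alpha>' + \<beta>' *\<^sub>R K"
  shows "\<alpha>' = \<alpha>" and "\<beta>' = \<beta> \<and> (\<beta> = 0 \<or> K = J) \<or> \<beta>' = - \<beta> \<and> (\<beta> = 0 \<or> K = - J)"
proof -
  have tr': "tr (of_real a + b *\<^sub>R L) = (of_real (a + a) :: 'a)" if "L \<in> unit_sphere" for a b L
  proof -
    have "u + v + (u - v) = u + u" for u v :: 'a by simp
    then show ?thesis
      unfolding tr_def star_add star_scaleR unit_sphere_star[OF that] star_of_real of_real_add
        scaleR_minus_right add_uminus_conv_diff .
  qed
  have "of_real (\<alpha> + \<alpha>) = (of_real (\<alpha>' + \<alpha>') :: 'a)"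
    unfolding tr'[OF J, of \<alpha> \<beta>, symmetric] tr'[OF K, of \<alpha>' \<beta>', symmetric] eq ..
  then show a: "\<alpha>' = \<alpha>"
    unfolding of_real_eq_iff by simp
  have eq': "\<beta> *\<^sub>R J = \<beta>' *\<^sub>R K"
    using eq unfolding a by (rule add_left_imp_eq)
  have "(\<beta> *\<^sub>R J) * (\<beta> *\<^sub>R J) = (\<beta>' *\<^sub>R K) * (\<beta>' *\<^sub>R K)"
    unfolding eq' ..
  then have "of_real (\<beta> * \<beta>) = (of_real (\<beta>' * \<beta>') :: 'a)"
    unfolding mult_scaleR_left mult_scaleR_right scaleR_scaleR unit_sphere_square[OF J]
      unit_sphere_square[OF K] scaleR_minus_right neg_equal_iff_equal of_real_def .
  then have "\<beta> * \<beta> = \<beta>' * \<beta>'"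
    by (simp only: of_real_eq_iff)
  then have "\<beta>' = \<beta> \<or> \<beta>' = - \<beta>"
    unfolding square_eq_iff by auto
  moreover have "\<beta> = 0 \<or> K = J" if "\<beta>' = \<beta>"
    using eq' unfolding that real_vector.scale_cancel_left by blast
  moreover have "\<beta> = 0 \<or> K = - J" if "\<beta>' = - \<beta>"
  proof -
    have "\<beta> *\<^sub>R (J + K) = 0"
      unfolding scaleR_add_right eq' that by simp
    then have "\<beta> = 0 \<or> J + K = 0"
      unfolding scaleR_eq_0_iff .
    then show ?thesis
      unfolding add_eq_0_iff .
  qed
  ultimately show "\<beta>' = \<beta> \<and> (\<beta> = 0 \<or> K = J) \<or> \<beta>' = - \<beta> \<and> (\<beta> = 0 \<or> K = - J)"
    by blast
qed

lemma eq_uminus_imp_zero: "(x::'a::real_vector) = - x \<Longrightarrow> x = 0"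
  by (metis add.right_inverse one_neq_neg_one scaleR_one scaleR_minus1_left scaleR_right_imp_eq)

lemma slice_fun_eq:
  fixes J :: "'a::star_algebra"
  assumes F: "stem_function D F" and z: "Complex \<alpha> \<beta> \<in> D" and J: "J \<in> unit_sphere"
  shows "slice_fun D F (of_real \<alpha> + \<beta> *\<^sub>R J) =
    part1 (F (Complex \<alpha> \<beta>)) + J * part2 (F (Complex \<alpha> \<beta>))"
  unfolding slice_fun_def
proof (rule the_equality)
  fix w
  assume "\<exists>\<alpha>' \<beta>' K. Complex \<alpha>' \<beta>' \<in> D \<and> K \<in> unit_sphere \<and>
    of_real \<alpha> + \<beta> *\<^sub>R J = of_real \<alpha>' + \<beta>' *\<^sub>R K \<and>
    w = part1 (F (Complex \<alpha>' \<beta>')) + K * part2 (F (Complex \<alpha>' \<beta>'))"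
  then obtain \<alpha>' \<beta>' K where K: "K \<in> unit_sphere"
    and eq: "of_real \<alpha> + \<beta> *\<^sub>R J = of_real \<alpha>' + \<beta>' *\<^sub>R K"
    and w: "w = part1 (F (Complex \<alpha>' \<beta>')) + K * part2 (F (Complex \<alpha>' \<beta>'))"
    by blast
  have sym: "part1 (F (Complex \<alpha> (- \<beta>))) = part1 (F (Complex \<alpha> \<beta>))"
    "part2 (F (Complex \<alpha> (- \<beta>))) = - part2 (F (Complex \<alpha> \<beta>))"
    using F z by (auto simp: stem_function_def complex_cnj dest: bspec[of _ _ "Complex \<alpha> \<beta>"])
  have zero: "part2 (F (Complex \<alpha> \<beta>)) = 0" if "\<beta> = 0"
    using sym(2) that eq_uminus_imp_zero by auto
  note rep = sphere_representation_unique[OF J K eq]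
  from rep(2) show "w = part1 (F (Complex \<alpha> \<beta>)) + J * part2 (F (Complex \<alpha> \<beta>))"
  proof (elim disjE conjE)
    assume "\<beta>' = \<beta>" "\<beta> = 0"
    then show ?thesis using w rep(1) zero by simp
  next
    assume "\<beta>' = \<beta>" "K = J"
    then show ?thesis using w rep(1) by simp
  next
    assume "\<beta>' = - \<beta>" "\<beta> = 0"
    then show ?thesis using w rep(1) zero by simp
  next
    assume "\<beta>' = - \<beta>" "K = - J"
    then show ?thesis using w rep(1) sym by simp
  qed
qed (use z J in blast)

lemma stem_function_unique:
  fixes f :: "'a::star_algebra \<Rightarrow> 'a"
  assumes ne: "(unit_sphere :: 'a set) \<noteq> {}"
    and F: "induced_by D f F" and G: "induced_by D f G" and z: "z \<in> D"
  shows "F z = G z"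
proof -
  from ne obtain J :: 'a where J: "J \<in> unit_sphere" by blast
  obtain \<alpha> \<beta> where ab: "z = Complex \<alpha> \<beta>" by (cases z)
  have val: "f (of_real \<alpha> + \<beta> *\<^sub>R L) = part1 (H z) + L * part2 (H z)"
    if "induced_by D f H" "L \<in> unit_sphere" for H L
  proof -
    have "of_real \<alpha> + \<beta> *\<^sub>R L \<in> Omega D"
      using that z ab by (auto simp: Omega_def)
    then show ?thesis
      using that z ab slice_fun_eq[of D H \<alpha> \<beta> L] by (auto simp: induced_by_def)
  qed
  define a b where "a = part1 (F z) - part1 (G z)" and "b = J * part2 (F z) - J * part2 (G z)"
  have "part1 (F z) + J * part2 (F z) - (part1 (G z) + J * part2 (G z)) = 0"
    unfolding val[OF F J, symmetric] val[OF G J, symmetric] by (rule diff_self)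
  then have 1: "a + b = 0"
    by (simp add: a_def b_def algebra_simps)
  have "part1 (F z) + - J * part2 (F z) = part1 (G z) + - J * part2 (G z)"
    using val[OF F unit_sphere_uminus[OF J]] val[OF G unit_sphere_uminus[OF J]] by (rule trans[OF sym])
  then have "part1 (F z) - J * part2 (F z) - (part1 (G z) - J * part2 (G z)) = 0"
    by simp
  then have 2: "a - b = 0"
    by (simp add: a_def b_def algebra_simps)
  have "b = - b" using 1 2 by (simp add: add_eq_0_iff)
  then have b: "b = 0" by (rule eq_uminus_imp_zero)
  then have a: "a = 0" using 1 by simp
  have "J * (J * (part2 (F z) - part2 (G z))) = 0"
    using b by (simp add: b_def algebra_simps)
  then have "part2 (F z) = part2 (G z)"
    by (simp add: mult.assoc[symmetric] unit_sphere_square[OF J])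
  then show ?thesis
    using a by (simp add: a_def complexified.expand)
qed

lemma unit_sphere_quat_nonempty: "(unit_sphere :: quat set) \<noteq> {}"
proof -
  have "Quat 0 1 0 0 \<in> unit_sphere"
    by (simp add: unit_sphere_def tr_def nm_def quat_ops_defs)
  then show ?thesis by blast
qed

lemma unit_sphere_Dual_iff [simp]:
  "Dual J 0 \<in> unit_sphere \<longleftrightarrow> (J :: 'a::star_algebra) \<in> unit_sphere"
proof -
  have "star (0::'a) = 0" using star_scaleR[of 0 "0::'a"] by simp
  then show ?thesis by (simp add: unit_sphere_def tr_def nm_def dual_ops_defs)
qed

lemma unit_sphere_dual_quat_nonempty: "(unit_sphere :: dual_quat set) \<noteq> {}"
  using unit_sphere_quat_nonempty unit_sphere_Dual_iff by blast

lemma stem_of_eq: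
  assumes "(unit_sphere :: 'a::star_algebra set) \<noteq> {}"
    and "induced_by D (f :: 'a \<Rightarrow> 'a) F" and "z \<in> D"
  shows "stem_of D f z = F z"
proof -
  have "induced_by D f (stem_of D f)"
    unfolding stem_of_def by (rule someI[of "induced_by D f", OF assms(2)])
  then show ?thesis using stem_function_unique assms by blast
qed

lemma induced_byI:
  assumes st: "stem_function D F"
    and val: "\<And>\<alpha> \<beta> J. Complex \<alpha> \<beta> \<in> D \<Longrightarrow> J \<in> unit_sphere \<Longrightarrow>
      f (of_real \<alpha> + \<beta> *\<^sub>R J) = part1 (F (Complex \<alpha> \<beta>)) + J * part2 (F (Complex \<alpha> \<beta>))"
  shows "induced_by D f F"
  unfolding induced_by_def
proof (intro conjI st ballI)
  fix x :: 'a assume "x \<in> Omega D"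
  then obtain \<alpha> \<beta> J where *: "x = of_real \<alpha> + \<beta> *\<^sub>R J" "Complex \<alpha> \<beta> \<in> D" "J \<in> unit_sphere"
    unfolding Omega_def by blast
  show "f x = slice_fun D F x"
    unfolding *(1) using val[OF *(2,3)] slice_fun_eq[OF st *(2,3)] by (rule trans[OF _ sym])
qed

lemma induced_by_slice_mult:
  fixes f g :: "'a::star_algebra \<Rightarrow> 'a"
  assumes ne: "(unit_sphere :: 'a set) \<noteq> {}" and D: "\<forall>z\<in>D. cnj z \<in> D"
    and F: "induced_by D f F" and G: "induced_by D g G"
  shows "induced_by D (slice_mult D f g) (\<lambda>z. F z * G z)"
proof (rule induced_byI)
  show st: "stem_function D (\<lambda>z. F z * G z)"
    using F G by (simp add: induced_by_def stem_function_def complexified_ops_defs)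
  have eq: "stem_of D f z * stem_of D g z = F z * G z" if "z \<in> D" for z
    using stem_of_eq[OF ne F that] stem_of_eq[OF ne G that] by simp
  have st': "stem_function D (\<lambda>z. stem_of D f z * stem_of D g z)"
    using st D by (auto simp: stem_function_def eq)
  fix \<alpha> \<beta> and J :: 'a assume z: "Complex \<alpha> \<beta> \<in> D" and J: "J \<in> unit_sphere"
  show "slice_mult D f g (of_real \<alpha> + \<beta> *\<^sub>R J) =
      part1 (F (Complex \<alpha> \<beta>) * G (Complex \<alpha> \<beta>)) + J * part2 (F (Complex \<alpha> \<beta>) * G (Complex \<alpha> \<beta>))"
    unfolding slice_mult_def slice_fun_eq[OF st' z J] eq[OF z] ..
qed

lemma induced_by_linear:
  "induced_by D (\<lambda>x :: 'a::star_algebra. x - y)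
    (\<lambda>z. Cplx (of_real (Re z) - y) (of_real (Im z)))"
  by (rule induced_byI) (simp_all add: stem_function_def of_real_def)

lemma induced_by_quadratic:
  "induced_by D (\<lambda>x :: 'a::star_algebra. x\<^sup>2 - x * a + b)
    (\<lambda>z. Cplx (of_real (Re (z\<^sup>2)) - of_real (Re z) * a + b) (of_real (Im (z\<^sup>2)) - of_real (Im z) * a))"
proof (rule induced_byI)
  fix \<alpha> \<beta> and J :: 'a assume J: "J \<in> unit_sphere"
  define z where "z = Complex \<alpha> \<beta>"
  define R I :: 'a where "R = of_real (Re (z\<^sup>2))" and "I = of_real (Im (z\<^sup>2))"
  have "Re (z\<^sup>2) = \<alpha> * \<alpha> - \<beta> * \<beta>" "Im (z\<^sup>2) = \<alpha> * \<beta> + \<alpha> * \<beta>"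
    by (simp_all add: z_def power2_eq_square)
  then have "(of_real \<alpha> + \<beta> *\<^sub>R J)\<^sup>2 = R + J * I"
    using unit_sphere_square[OF J]
    by (simp add: R_def I_def of_real_def power2_eq_square distrib_left distrib_right
        scaleR_left_diff_distrib scaleR_add_left scaleR_add_right scaleR_diff_right mult.commute flip: scaleR_2)
  moreover have "R + J * I - (of_real \<alpha> + \<beta> *\<^sub>R J) * a + b =
      (R - of_real \<alpha> * a + b) + J * (I - of_real \<beta> * a)"
    by (simp add: of_real_def distrib_right right_diff_distrib)
  ultimately show "(of_real \<alpha> + \<beta> *\<^sub>R J)\<^sup>2 - (of_real \<alpha> + \<beta> *\<^sub>R J) * a + b =
      part1 (Cplx (of_real (Re ((Complex \<alpha> \<beta>)\<^sup>2)) - of_real (Re (Complex \<alpha> \<beta>)) * a + b)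
        (of_real (Im ((Complex \<alpha> \<beta>)\<^sup>2)) - of_real (Im (Complex \<alpha> \<beta>)) * a)) +
      J * part2 (Cplx (of_real (Re ((Complex \<alpha> \<beta>)\<^sup>2)) - of_real (Re (Complex \<alpha> \<beta>)) * a + b)
        (of_real (Im ((Complex \<alpha> \<beta>)\<^sup>2)) - of_real (Im (Complex \<alpha> \<beta>)) * a))"
    by (simp only: complexified.sel complex.sel R_def I_def z_def)
qed (simp add: stem_function_def power2_eq_square)

lemma dual_of_real: "(of_real r :: 'a::star_algebra dual_number) = Dual (of_real r) 0"
  by (simp add: of_real_def dual_ops_defs)

lemma Omega_quat_iff: "q \<in> (Omega D :: quat set) \<longleftrightarrow> Dual q 0 \<in> (Omega D :: dual_quat set)"
proof
  assume "q \<in> Omega D"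
  then obtain \<alpha> \<beta> J where *: "q = of_real \<alpha> + \<beta> *\<^sub>R J" "Complex \<alpha> \<beta> \<in> D" "J \<in> unit_sphere"
    by (auto simp: Omega_def)
  have "Dual q 0 = of_real \<alpha> + \<beta> *\<^sub>R Dual J 0"
    using * by (simp add: dual_of_real dual_vector_defs)
  then show "Dual q 0 \<in> Omega D"
    unfolding Omega_def using * unit_sphere_Dual_iff by blast
next
  assume "Dual q 0 \<in> (Omega D :: dual_quat set)"
  then obtain \<alpha> \<beta> and J :: dual_quat
    where *: "Dual q 0 = of_real \<alpha> + \<beta> *\<^sub>R J" "Complex \<alpha> \<beta> \<in> D" "J \<in> unit_sphere"
    by (auto simp: Omega_def)
  have "primal J \<in> unit_sphere"
    using *(3) by (simp add: unit_sphere_def tr_def nm_def dual_ops_defs)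
  moreover have "q = of_real \<alpha> + \<beta> *\<^sub>R primal J"
    using *(1) by (simp add: dual_of_real dual_vector_defs)
  ultimately show "q \<in> Omega D"
    unfolding Omega_def using *(2) by blast
qed

end

theory Submission
  imports Defs
begin

text \<open>Cofactors need only be slice functions, so divisibility can be tested on stem functions one
  point at a time. With \<open>y = \<alpha> + \<beta> J\<close> and \<open>w = \<alpha> + i \<beta>\<close>, the stem of \<open>x - y\<close> times its conjugate is
  the central element \<open>(z - w) (z - cnj w)\<close>, the stem of the real quadratic polynomial; so both
  divisors are invertible at \<open>z\<close> unless \<open>z\<close> is \<open>w\<close> or \<open>cnj w\<close>. At \<open>w\<close> the quadratic vanishes,
  while \<open>x - y\<close> has the value \<open>\<beta> (\<iota> - J)\<close>, and \<open>F\<^sub>1 + \<iota> F\<^sub>2\<close> is a right multiple of \<open>\<iota> - J\<close> exactly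
  if \<open>F\<^sub>1 + J F\<^sub>2 = 0\<close>, in which case it equals \<open>(\<iota> - J) F\<^sub>2\<close>.\<close>

section \<open>Central complex scalars and conjugation in the complexified algebra\<close>

definition cplx_of :: "complex \<Rightarrow> 'a::star_algebra complexified" where
  "cplx_of w = Cplx (of_real (Re w)) (of_real (Im w))"

text \<open>This conjugates \<iota> alone and fixes the algebra, unlike \<open>star\<close>. It is
  multiplicative without reversing factors, so the parity conditions on a stem function become one
  equivariance that passes to products.\<close>

definition cplx_cnj :: "'a::star_algebra complexified \<Rightarrow> 'a complexified" where
  "cplx_cnj x = Cplx (part1 x) (- part2 x)"

lemma cplx_of_0 [simp]: "cplx_of 0 = 0"
  by (simp add: cplx_of_def zero_complexified_def)

lemma cplx_of_1 [simp]: "cplx_of 1 = 1"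
  by (simp add: cplx_of_def one_complexified_def)

lemma cplx_of_mult: "cplx_of (v * w) = cplx_of v * cplx_of w"
  by (simp add: cplx_of_def times_complexified_def)

lemma cplx_of_commute: "cplx_of w * x = x * cplx_of w"
  by (simp add: cplx_of_def times_complexified_def of_real_def)

lemma cplx_cnj_mult: "cplx_cnj (x * y) = cplx_cnj x * cplx_cnj y"
  by (simp add: cplx_cnj_def times_complexified_def)

lemma cplx_cnj_cplx_of: "cplx_cnj (cplx_of w) = cplx_of (cnj w)"
  by (simp add: cplx_cnj_def cplx_of_def)

lemma complexified_eq_0_iff: "x = 0 \<longleftrightarrow> part1 x = 0 \<and> part2 x = 0"
  by (cases x) (simp add: zero_complexified_def)

section \<open>Divisibility, conjugate, norm and primal part in terms of stem functions\<close>

lemma stem_function_iff_cplx_cnj: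
  "stem_function D F \<longleftrightarrow> (\<forall>z\<in>D. F (cnj z) = cplx_cnj (F z))"
  by (auto simp: stem_function_def cplx_cnj_def intro: complexified.expand)

lemma induced_by_slice_fun: "stem_function D F \<Longrightarrow> induced_by D (slice_fun D F) F"
  by (simp add: induced_by_def)

text \<open>A slice function determines its stem on \<open>D\<close>, so a factorization on
  \<open>Omega D\<close> is a pointwise factorization of stems. Conversely, any stem
  \<open>G\<close>, with no continuity asked of it, induces an admissible cofactor.\<close>

lemma slice_dvd_iff_stem:
  fixes f h :: "'a::star_algebra \<Rightarrow> 'a"
  assumes ne: "(unit_sphere :: 'a set) \<noteq> {}" and D: "\<forall>z\<in>D. cnj z \<in> D"
    and H: "induced_by D h H" and F: "induced_by D f F"
  shows "slice_dvd D h f \<longleftrightarrow> (\<exists>G. stem_function D G \<and> (\<forall>z\<in>D. F z = H z * G z))"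
proof
  assume "slice_dvd D h f"
  then obtain g G where G: "induced_by D g G" and eq: "\<forall>x\<in>Omega D. f x = slice_mult D h g x"
    by (auto simp: slice_dvd_def slice_functions_def)
  have "induced_by D f (\<lambda>z. H z * G z)"
    using induced_by_slice_mult[OF ne D H G] eq by (simp add: induced_by_def)
  then show "\<exists>G. stem_function D G \<and> (\<forall>z\<in>D. F z = H z * G z)"
    using stem_function_unique[OF ne F] G unfolding induced_by_def by blast
next
  assume "\<exists>G. stem_function D G \<and> (\<forall>z\<in>D. F z = H z * G z)"
  then obtain G where G: "stem_function D G" and eq: "\<forall>z\<in>D. F z = H z * G z"
    by blast
  note prod = induced_by_slice_mult[OF ne D H induced_by_slice_fun[OF G]]
  have "f x = slice_mult D h (slice_fun D G) x" if "x \<in> Omega D" for x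
  proof -
    from that obtain \<alpha> \<beta> J where x: "x = of_real \<alpha> + \<beta> *\<^sub>R J" "Complex \<alpha> \<beta> \<in> D" "J \<in> unit_sphere"
      unfolding Omega_def by blast
    have "slice_fun D F x = slice_fun D (\<lambda>z. H z * G z) x"
      using F prod eq x by (simp add: induced_by_def slice_fun_eq)
    then show ?thesis
      using F prod that by (simp add: induced_by_def)
  qed
  then show "slice_dvd D h f"
    using induced_by_slice_fun[OF G] by (auto simp: slice_dvd_def slice_functions_def)
qed

lemma induced_by_slice_conj:
  fixes f :: "'a::star_algebra \<Rightarrow> 'a"
  assumes ne: "(unit_sphere :: 'a set) \<noteq> {}" and D: "\<forall>z\<in>D. cnj z \<in> D" and F: "induced_by D f F"
  shows "induced_by D (slice_conj D f) (\<lambda>z. star (F z))"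
proof (rule induced_byI)
  have eq: "stem_of D f z = F z" if "z \<in> D" for z
    using stem_of_eq[OF ne F that] .
  have m: "star (- x) = - star x" for x :: 'a
    using star_scaleR[of "-1" x] by simp
  show "stem_function D (\<lambda>z. star (F z))"
    using F by (simp add: induced_by_def stem_function_def star_complexified_def m)
  then have st: "stem_function D (\<lambda>z. star (stem_of D f z))"
    using D by (simp add: stem_function_def eq)
  fix \<alpha> \<beta> and J :: 'a assume z: "Complex \<alpha> \<beta> \<in> D" and J: "J \<in> unit_sphere"
  show "slice_conj D f (of_real \<alpha> + \<beta> *\<^sub>R J) =
      part1 (star (F (Complex \<alpha> \<beta>))) + J * part2 (star (F (Complex \<alpha> \<beta>)))"
    unfolding slice_conj_def slice_fun_eq[OF st z J] eq[OF z] ..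
qed

lemma induced_by_slice_norm:
  fixes f :: "'a::star_algebra \<Rightarrow> 'a"
  assumes "(unit_sphere :: 'a set) \<noteq> {}" and "\<forall>z\<in>D. cnj z \<in> D" and "induced_by D f F"
  shows "induced_by D (slice_norm D f) (\<lambda>z. nm (F z))"
  unfolding slice_norm_def nm_def
  by (intro induced_by_slice_mult induced_by_slice_conj assms)

lemma induced_by_slice_primal:
  assumes D: "\<forall>z\<in>D. cnj z \<in> D" and F: "induced_by D f F"
  shows "induced_by D (slice_primal D f) (\<lambda>z. Cplx (primal (part1 (F z))) (primal (part2 (F z))))"
proof (rule induced_byI)
  have eq: "stem_of D f z = F z" if "z \<in> D" for z
    using stem_of_eq[OF unit_sphere_dual_quat_nonempty F that] .
  show "stem_function D (\<lambda>z. Cplx (primal (part1 (F z))) (primal (part2 (F z))))"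
    using F by (simp add: induced_by_def stem_function_def uminus_dual_number_def)
  then have st: "stem_function D
      (\<lambda>z. Cplx (primal (part1 (stem_of D f z))) (primal (part2 (stem_of D f z))))"
    using D by (simp add: stem_function_def eq)
  fix \<alpha> \<beta> and J :: quat assume z: "Complex \<alpha> \<beta> \<in> D" and J: "J \<in> unit_sphere"
  show "slice_primal D f (of_real \<alpha> + \<beta> *\<^sub>R J) =
      part1 (Cplx (primal (part1 (F (Complex \<alpha> \<beta>)))) (primal (part2 (F (Complex \<alpha> \<beta>))))) +
      J * part2 (Cplx (primal (part1 (F (Complex \<alpha> \<beta>)))) (primal (part2 (F (Complex \<alpha> \<beta>)))))"
    unfolding slice_primal_def slice_fun_eq[OF st z J] eq[OF z] ..
qed

section \<open>Divisibility by the real quadratic polynomial and by \<open>x - y\<close>\<close>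

lemma star_zero [simp]: "star (0 :: 'a::star_algebra) = 0"
  using star_scaleR[of 0 "0 :: 'a"] by simp

lemma star_slice_point:
  assumes J: "J \<in> (unit_sphere :: 'a::star_algebra set)"
  shows "star (of_real \<alpha> + \<beta> *\<^sub>R J) = of_real \<alpha> - \<beta> *\<^sub>R J"
  by (simp add: star_add star_scaleR of_real_def unit_sphere_star[OF J])

lemma tr_slice_point:
  assumes J: "J \<in> (unit_sphere :: 'a::star_algebra set)"
  shows "tr (of_real \<alpha> + \<beta> *\<^sub>R J) = of_real (2 * \<alpha>)"
  unfolding tr_def star_slice_point[OF J] mult_2 of_real_add by simp

lemma nm_slice_point:
  assumes J: "J \<in> (unit_sphere :: 'a::star_algebra set)"
  shows "nm (of_real \<alpha> + \<beta> *\<^sub>R J) = of_real (\<alpha>\<^sup>2 + \<beta>\<^sup>2)"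
  unfolding nm_def star_slice_point[OF J]
  by (simp add: of_real_def algebra_simps unit_sphere_square[OF J] power2_eq_square)

text \<open>The coefficients are real, so the stem takes values in the central copy of the complex
  numbers, where the polynomial splits into linear factors.\<close>

lemma induced_by_real_quadratic:
  "induced_by D (\<lambda>x :: 'a::star_algebra. x\<^sup>2 - x * of_real (2 * Re w) + of_real ((Re w)\<^sup>2 + (Im w)\<^sup>2))
    (\<lambda>z. cplx_of ((z - w) * (z - cnj w)))"
proof -
  have eq: "cplx_of ((z - w) * (z - cnj w)) =
      Cplx (of_real (Re (z\<^sup>2)) - of_real (Re z) * of_real (2 * Re w)
          + of_real ((Re w)\<^sup>2 + (Im w)\<^sup>2) :: 'a)
        (of_real (Im (z\<^sup>2)) - of_real (Im z) * of_real (2 * Re w))" for z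
    unfolding cplx_of_def of_real_mult[symmetric] of_real_diff[symmetric] of_real_add[symmetric]
    by (simp add: power2_eq_square algebra_simps)
  show ?thesis
    unfolding eq by (rule induced_by_quadratic)
qed

text \<open>The generality in the algebra matters: the criterion is applied to \<open>f\<close> and
  its norm over the dual quaternions, and to the primal part over the quaternions.\<close>

lemma dvd_real_quadratic_iff:
  fixes f :: "'a::star_algebra \<Rightarrow> 'a"
  assumes ne: "(unit_sphere :: 'a set) \<noteq> {}" and D: "\<forall>z\<in>D. cnj z \<in> D" and w: "w \<in> D"
    and F: "induced_by D f F"
  shows "slice_dvd D (\<lambda>x. x\<^sup>2 - x * of_real (2 * Re w) + of_real ((Re w)\<^sup>2 + (Im w)\<^sup>2)) f \<longleftrightarrow> F w = 0"
    (is "slice_dvd D ?q f \<longleftrightarrow> _")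
proof -
  define p where "p z = (z - w) * (z - cnj w)" for z
  have p: "induced_by D ?q (\<lambda>z. cplx_of (p z))"
    unfolding p_def by (rule induced_by_real_quadratic)
  have st: "F (cnj z) = cplx_cnj (F z)" if "z \<in> D" for z
    using F that by (simp add: induced_by_def stem_function_iff_cplx_cnj)
  have pc: "p (cnj z) = cnj (p z)" for z
    by (simp add: p_def mult.commute)
  show ?thesis
    unfolding slice_dvd_iff_stem[OF ne D p F]
  proof
    assume "\<exists>G. stem_function D G \<and> (\<forall>z\<in>D. F z = cplx_of (p z) * G z)"
    then show "F w = 0"
      using w by (auto simp: p_def)
  next
    assume F0: "F w = 0"
    \<comment> \<open>Since \<open>inverse 0 = 0\<close>, this \<open>G\<close> is zero at the roots
      \<open>w\<close> and \<open>cnj w\<close> of \<open>p\<close>. \<open>F\<close> vanishes at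
      both, by assumption and by the stem symmetry, so no separate choice is required there.\<close>
    define G where "G z = cplx_of (inverse (p z)) * F z" for z
    have "stem_function D G"
      by (simp add: stem_function_iff_cplx_cnj G_def cplx_cnj_mult cplx_cnj_cplx_of st pc)
    moreover have "F z = cplx_of (p z) * G z" if "z \<in> D" for z
    proof (cases "p z = 0")
      case True
      then have "z = w \<or> z = cnj w"
        by (simp add: p_def)
      then have "F z = 0"
        using F0 st[OF w] by (auto simp: cplx_cnj_def zero_complexified_def)
      then show ?thesis
        by (simp add: G_def)
    next
      case False
      then show ?thesis
        by (simp add: G_def mult.assoc[symmetric] cplx_of_mult[symmetric])
    qed
    ultimately show "\<exists>G. stem_function D G \<and> (\<forall>z\<in>D. F z = cplx_of (p z) * G z)"
      by blast
  qed
qed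

text \<open>With \<open>u\<close> and \<open>t\<close> as in the proof, the factors are (u + \<iota>
  t) - \<beta> J and (u + \<iota> t) + \<beta> J. As u + \<iota> t is central and J squares to -1,
  the product is (u + \<iota> t)^2 + \<beta>^2.\<close>

lemma linear_stem_mult_conj:
  assumes J: "J \<in> (unit_sphere :: 'a::star_algebra set)" and y: "y = of_real \<alpha> + \<beta> *\<^sub>R J"
  shows "Cplx (of_real (Re z) - y) (of_real (Im z)) * Cplx (of_real (Re z) - star y) (of_real (Im z))
    = cplx_of ((z - Complex \<alpha> \<beta>) * (z - cnj (Complex \<alpha> \<beta>)))"
proof -
  define u t where "u = Re z - \<alpha>" and "t = Im z"
  have 1: "of_real (Re z) - y = u *\<^sub>R 1 - \<beta> *\<^sub>R J" "of_real (Re z) - star y = u *\<^sub>R 1 + \<beta> *\<^sub>R J"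
    unfolding y star_slice_point[OF J] by (simp_all add: u_def of_real_def scaleR_left_diff_distrib)
  have 2: "(z - Complex \<alpha> \<beta>) * (z - cnj (Complex \<alpha> \<beta>)) =
      Complex (u * u + \<beta> * \<beta> - t * t) (u * t + u * t)"
    by (simp add: complex_eq_iff u_def t_def algebra_simps)
  show ?thesis
    unfolding 1 2
    unfolding cplx_of_def of_real_def complex.sel scaleR_left_distrib t_def[symmetric]
    by (simp add: times_complexified_def algebra_simps unit_sphere_square[OF J])
qed

text \<open>Necessity: applying a + \<iota> b |-> a + J b to (\<iota> - J) g gives 0, and for the
  stem of \<open>f\<close> at \<open>?w\<close> this map returns \<open>f y\<close>. Sufficiency:
  away from the roots of \<open>p\<close>, the stem \<open>L\<close> is inverted by means of
  \<open>K\<close>; at the roots an explicit quotient is chosen.\<close>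

lemma dvd_linear_iff:
  fixes f :: "'a::star_algebra \<Rightarrow> 'a"
  assumes D: "\<forall>z\<in>D. cnj z \<in> D" and w: "Complex \<alpha> \<beta> \<in> D" and F: "induced_by D f F"
    and J: "J \<in> unit_sphere" and y: "y = of_real \<alpha> + \<beta> *\<^sub>R J"
  shows "slice_dvd D (\<lambda>x. x - y) f \<longleftrightarrow> f y = 0"
proof -
  from J have ne: "(unit_sphere :: 'a set) \<noteq> {}" by blast
  let ?w = "Complex \<alpha> \<beta>"
  define L where "L z = Cplx (of_real (Re z) - y) (of_real (Im z))" for z
  define K where "K z = Cplx (of_real (Re z) - star y) (of_real (Im z))" for z
  define p where "p z = (z - ?w) * (z - cnj ?w)" for z
  have LK: "L z * K z = cplx_of (p z)" for z
    unfolding L_def K_def p_def by (rule linear_stem_mult_conj[OF J y])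
  have L: "induced_by D (\<lambda>x. x - y) L"
    unfolding L_def by (rule induced_by_linear)
  have stF: "stem_function D F"
    using F by (simp add: induced_by_def)
  then have st: "F (cnj z) = cplx_cnj (F z)" if "z \<in> D" for z
    using that by (simp add: stem_function_iff_cplx_cnj)
  have "y \<in> Omega D"
    unfolding Omega_def using y w J by blast
  then have fy: "f y = part1 (F ?w) + J * part2 (F ?w)"
    using F slice_fun_eq[OF stF w J] by (simp add: induced_by_def y)
  have JJ: "J * (J * a) = - a" for a
    by (simp add: mult.assoc[symmetric] unit_sphere_square[OF J])
  show ?thesis
    unfolding slice_dvd_iff_stem[OF ne D L F]
  proof
    assume "\<exists>G. stem_function D G \<and> (\<forall>z\<in>D. F z = L z * G z)"
    then obtain G where "F ?w = L ?w * G ?w"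
      using w by blast
    then show "f y = 0"
      unfolding fy by (simp add: L_def y times_complexified_def of_real_def algebra_simps JJ)
  next
    assume "f y = 0"
    then have F1: "part1 (F ?w) = - (J * part2 (F ?w))"
      by (simp add: fy eq_neg_iff_add_eq_0)
    define G where "G z = (if p z = 0 then Cplx (part2 (F z) /\<^sub>R Im z) 0
      else cplx_of (inverse (p z)) * (K z * F z))" for z
    have pc: "p (cnj z) = cnj (p z)" for z
      by (simp add: p_def mult.commute)
    have Kc: "K (cnj z) = cplx_cnj (K z)" for z
      by (simp add: K_def cplx_cnj_def)
    have "G (cnj z) = cplx_cnj (G z)" if "z \<in> D" for z
    proof (cases "p z = 0")
      case True
      then show ?thesis
        by (simp add: G_def pc st[OF that]) (simp add: cplx_cnj_def)
    next
      case False
      then show ?thesis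
        by (simp add: G_def pc st[OF that] Kc cplx_cnj_mult cplx_cnj_cplx_of)
    qed
    then have "stem_function D G"
      by (simp add: stem_function_iff_cplx_cnj)
    moreover have "F z = L z * G z" if "z \<in> D" for z
    proof (cases "p z = 0")
      case False
      have "L z * G z = cplx_of (inverse (p z)) * (L z * K z) * F z"
        using False by (simp add: G_def) (metis mult.assoc cplx_of_commute)
      then show ?thesis
        using False by (simp add: LK cplx_of_mult[symmetric])
    next
      case True
      \<comment> \<open>For real \<open>y\<close> the quotient is a division by zero with value 0.
        This is correct, because the odd component vanishes at real points and then
        \<open>F1\<close> forces \<open>F ?w = 0\<close>.\<close>
      have real: "part2 (F ?w) = 0" if "\<beta> = 0"
      proof -
        have "cnj ?w = ?w" using that by (simp add: complex_eq_iff)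
        then have "part2 (F ?w) = - part2 (F ?w)"
          using stF w unfolding stem_function_def by metis
        then show ?thesis by (rule eq_uminus_imp_zero)
      qed
      have "L ?w * Cplx (part2 (F ?w) /\<^sub>R \<beta>) 0 = F ?w"
        using real F1 by (cases "\<beta> = 0")
          (auto simp: L_def y times_complexified_def of_real_def intro!: complexified.expand)
      moreover have "L (cnj ?w) * Cplx (part2 (F (cnj ?w)) /\<^sub>R (- \<beta>)) 0 = F (cnj ?w)"
        using real F1 unfolding st[OF w] by (cases "\<beta> = 0")
          (auto simp: cplx_cnj_def L_def y times_complexified_def of_real_def
            intro!: complexified.expand)
      moreover have "z = ?w \<or> z = cnj ?w"
        using True by (simp add: p_def)
      ultimately show ?thesis
        using True by (auto simp: G_def)
    qed
    ultimately show "\<exists>G. stem_function D G \<and> (\<forall>z\<in>D. F z = L z * G z)"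
      by blast
  qed
qed

section \<open>Centrality of norms, and the quadratic divisor of N(f)\<close>

lemma quat_mult_star_add_real:
  fixes a b :: quat
  obtains r where "a * star b + b * star a = r *\<^sub>R 1"
proof
  \<comment> \<open>The real number is twice the Euclidean inner product of \<open>a\<close> and
    \<open>b\<close>.\<close>
  show "a * star b + b * star a =
      (2 * (qre a * qre b + qi a * qi b + qj a * qj b + qk a * qk b)) *\<^sub>R 1"
    by (simp add: quat_ops_defs)
qed

text \<open>The polarized norm is computed componentwise from the quaternionic one, so its values
  lie among the dual numbers with real components, which are central.\<close>

lemma dual_quat_mult_star_add_commute:
  fixes a b c :: dual_quat
  shows "(a * star b + b * star a) * c = c * (a * star b + b * star a)"
proof -
  obtain r where r: "primal a * star (primal b) + primal b * star (primal a) = r *\<^sub>R 1"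
    by (rule quat_mult_star_add_real)
  obtain s where s: "primal a * star (eps_part b) + eps_part b * star (primal a) = s *\<^sub>R 1"
    by (rule quat_mult_star_add_real)
  obtain t where t: "eps_part a * star (primal b) + primal b * star (eps_part a) = t *\<^sub>R 1"
    by (rule quat_mult_star_add_real)
  have "a * star b + b * star a = Dual (r *\<^sub>R 1) (s *\<^sub>R 1 + t *\<^sub>R 1)"
    unfolding r[symmetric] s[symmetric] t[symmetric] by (simp add: dual_ops_defs)
  then show ?thesis
    by (simp add: dual_ops_defs algebra_simps)
qed

lemma dual_quat_mult_star_commute:
  fixes a c :: dual_quat
  shows "(a * star a) * c = c * (a * star a)"
proof -
  have "2 *\<^sub>R ((a * star a) * c) = 2 *\<^sub>R (c * (a * star a))"
    using dual_quat_mult_star_add_commute[of a a c]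
    by (simp only: scaleR_2 distrib_left distrib_right)
  then show ?thesis
    by (simp only: scaleR_cancel_left) simp
qed

text \<open>The first component of \<open>nm x\<close> is a difference of norms and the second is a
  polarized norm. Both are central in the dual quaternions, and \<iota> is central as well.\<close>

lemma nm_complexified_commute:
  fixes x c :: "dual_quat complexified"
  shows "nm x * c = c * nm x"
proof -
  have "nm x = Cplx (part1 x * star (part1 x) - part2 x * star (part2 x))
      (part1 x * star (part2 x) + part2 x * star (part1 x))"
    by (simp add: nm_def times_complexified_def star_complexified_def)
  then show ?thesis
    by (simp add: times_complexified_def dual_quat_mult_star_add_commute
        dual_quat_mult_star_commute left_diff_distrib
        right_diff_distrib)
qed

text \<open>From F = L G follows n(F) = L n(G) L^c = n(G) n(L), because n(G) is central. At
  \<open>Complex \<alpha> \<beta>\<close> the factor n(L) vanishes, and the criterion for the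
  quadratic polynomial applies to the stem of N(f).\<close>

lemma dvd_slice_norm:
  fixes f :: "dual_quat \<Rightarrow> dual_quat"
  assumes D: "\<forall>z\<in>D. cnj z \<in> D" and F: "induced_by D f F" and y: "y \<in> Omega D"
    and dvd: "slice_dvd D (\<lambda>x. x - y) f"
  shows "slice_dvd D (\<lambda>x. x\<^sup>2 - x * tr y + nm y) (slice_norm D f)"
proof -
  note ne = unit_sphere_dual_quat_nonempty
  from y obtain \<alpha> \<beta> J where y_eq: "y = of_real \<alpha> + \<beta> *\<^sub>R J" and w: "Complex \<alpha> \<beta> \<in> D"
    and J: "J \<in> unit_sphere"
    unfolding Omega_def by blast
  define L where "L z = Cplx (of_real (Re z) - y) (of_real (Im z))" for z
  from dvd obtain G where G: "F z = L z * G z" if "z \<in> D" for z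
    unfolding slice_dvd_iff_stem[OF ne D induced_by_linear F] L_def by blast
  let ?w = "Complex \<alpha> \<beta>"
  have "star (L ?w) = Cplx (of_real (Re ?w) - star y) (of_real (Im ?w))"
    by (simp add: L_def star_complexified_def star_diff of_real_def star_scaleR)
  then have LL: "nm (L ?w) = 0"
    using linear_stem_mult_conj[OF J y_eq, of ?w] by (simp add: nm_def L_def)
  have "nm (F ?w) = L ?w * nm (G ?w) * star (L ?w)"
    by (simp add: G[OF w] nm_def star_mult mult.assoc)
  also have "\<dots> = nm (G ?w) * nm (L ?w)"
    by (simp add: nm_complexified_commute[symmetric] nm_def[of "L ?w"] mult.assoc)
  finally have "nm (F ?w) = 0"
    by (simp add: LL)
  then show ?thesis
    using dvd_real_quadratic_iff[OF ne D w induced_by_slice_norm[OF ne D F]]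
    by (simp add: y_eq tr_slice_point[OF J] nm_slice_point[OF J])
qed

section \<open>The sets \<open>T_set\<close> and \<open>sphere_of\<close>, and vanishing on
  them\<close>

lemma nonzero_imag_perp_exists:
  assumes "q \<in> imag_quats"
  shows "\<exists>k\<in>imag_quats. k \<noteq> 0 \<and> quat_perp k q"
proof (cases "qi q = 0 \<and> qj q = 0")
  case True
  then have "quat_perp (Quat 0 1 0 0) q"
    using assms by (simp add: quat_perp_def imag_quats_def quat_ops_defs)
  then show ?thesis
    by (intro bexI[of _ "Quat 0 1 0 0"]) (simp_all add: imag_quats_def zero_quat_def)
next
  case False
  \<comment> \<open>The witness is the cross product of the unit k with \<open>q\<close>; it is zero
    exactly when the other case applies.\<close>
  then have "quat_perp (Quat 0 (- qj q) (qi q) 0) q"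
    using assms by (simp add: quat_perp_def imag_quats_def quat_ops_defs)
  then show ?thesis
    using False by (intro bexI[of _ "Quat 0 (- qj q) (qi q) 0"])
      (auto simp add: imag_quats_def zero_quat_def)
qed

text \<open>Multiplying by \<open>star p\<close> on the left turns \<open>p\<close> into a positive
  real. Dual quaternions do have zero divisors, so only primal parts can be cancelled this
  way.\<close>

lemma quat_mult_eq_0:
  fixes p q :: quat
  assumes "p * q = 0" and "p \<noteq> 0"
  shows "q = 0"
proof -
  define n where "n = (qre p)\<^sup>2 + (qi p)\<^sup>2 + (qj p)\<^sup>2 + (qk p)\<^sup>2"
  have "star p * p = n *\<^sub>R 1"
    by (simp add: quat_ops_defs n_def power2_eq_square algebra_simps)
  then have "n *\<^sub>R q = star p * (p * q)"
    by (simp add: mult.assoc[symmetric])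
  moreover have "n \<noteq> 0"
    using \<open>p \<noteq> 0\<close> by (cases p) (auto simp: n_def zero_quat_def add_nonneg_eq_0_iff)
  ultimately show ?thesis
    using assms(1) by simp
qed

lemma quat_imag_slice_point:
  assumes "J \<in> (unit_sphere :: quat set)"
  shows "J \<in> imag_quats" and "quat_imag (of_real \<alpha> + \<beta> *\<^sub>R J) = \<beta> *\<^sub>R J"
proof -
  show *: "J \<in> imag_quats"
    using assms by (simp add: unit_sphere_def tr_def imag_quats_def quat_ops_defs)
  then show "quat_imag (of_real \<alpha> + \<beta> *\<^sub>R J) = \<beta> *\<^sub>R J"
    by (simp add: quat_imag_def imag_quats_def of_real_def quat_ops_defs)
qed

lemma quat_perp_scaleR:
  "\<beta> \<noteq> 0 \<Longrightarrow> quat_perp (\<beta> *\<^sub>R p) q \<longleftrightarrow> quat_perp p q"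
  "\<beta> \<noteq> 0 \<Longrightarrow> quat_perp p (\<beta> *\<^sub>R q) \<longleftrightarrow> quat_perp p q"
  by (simp_all add: quat_perp_def star_scaleR flip: scaleR_add_right)

lemma imag_quats_scaleR: "\<beta> \<noteq> 0 \<Longrightarrow> \<beta> *\<^sub>R p \<in> imag_quats \<longleftrightarrow> p \<in> imag_quats"
  by (simp add: imag_quats_def scaleR_quat_def)

text \<open>The \<epsilon>-component of the equation n = 1 is the orthogonality relation.\<close>

lemma Dual_in_unit_sphere_iff:
  "Dual J k \<in> unit_sphere \<longleftrightarrow> J \<in> unit_sphere \<and> k \<in> imag_quats \<and> quat_perp k J"
proof -
  have "k + star k = 0 \<longleftrightarrow> k \<in> imag_quats"
    by (simp add: imag_quats_def quat_ops_defs)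
  then show ?thesis
    by (auto simp: unit_sphere_def tr_def nm_def dual_ops_defs quat_perp_def add.commute)
qed

lemma T_set_slice_point:
  assumes J: "J \<in> (unit_sphere :: dual_quat set)" and \<beta>: "\<beta> \<noteq> 0"
  shows "T_set (primal (of_real \<alpha> + \<beta> *\<^sub>R J)) =
    {of_real \<alpha> + \<beta> *\<^sub>R K | K. K \<in> unit_sphere \<and> primal K = primal J}"
proof -
  have J1: "primal J \<in> unit_sphere"
    using J Dual_in_unit_sphere_iff[of "primal J" "eps_part J"] by simp
  have y1: "primal (of_real \<alpha> + \<beta> *\<^sub>R J) = of_real \<alpha> + \<beta> *\<^sub>R primal J"
    by (simp add: dual_of_real dual_vector_defs)
  have mem: "Dual (of_real \<alpha> + \<beta> *\<^sub>R primal J) (\<beta> *\<^sub>R k) = of_real \<alpha> + \<beta> *\<^sub>R Dual (primal J) k" for k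
    by (simp add: dual_of_real dual_vector_defs)
  have T: "Dual (of_real \<alpha> + \<beta> *\<^sub>R primal J) \<gamma> \<in> T_set (of_real \<alpha> + \<beta> *\<^sub>R primal J)
      \<longleftrightarrow> Dual (primal J) (\<gamma> /\<^sub>R \<beta>) \<in> unit_sphere" for \<gamma>
    using \<beta> J1 by (simp add: T_set_def quat_imag_slice_point Dual_in_unit_sphere_iff
        quat_perp_scaleR imag_quats_scaleR)
  show ?thesis
    unfolding y1
  proof (intro set_eqI iffI)
    fix x assume x: "x \<in> T_set (of_real \<alpha> + \<beta> *\<^sub>R primal J)"
    then obtain \<gamma> where g: "x = Dual (of_real \<alpha> + \<beta> *\<^sub>R primal J) \<gamma>"
      by (auto simp: T_set_def)
    have "x = of_real \<alpha> + \<beta> *\<^sub>R Dual (primal J) (\<gamma> /\<^sub>R \<beta>)"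
      unfolding g mem[symmetric] using \<beta> by simp
    then show "x \<in> {of_real \<alpha> + \<beta> *\<^sub>R K | K. K \<in> unit_sphere \<and> primal K = primal J}"
      using x T[of \<gamma>] g by force
  next
    fix x assume "x \<in> {of_real \<alpha> + \<beta> *\<^sub>R K | K. K \<in> unit_sphere \<and> primal K = primal J}"
    then obtain K where "K \<in> unit_sphere" "primal K = primal J" "x = of_real \<alpha> + \<beta> *\<^sub>R K"
      by blast
    then obtain k where k: "Dual (primal J) k \<in> unit_sphere"
      and x: "x = of_real \<alpha> + \<beta> *\<^sub>R Dual (primal J) k"
      by (cases K) simp
    show "x \<in> T_set (of_real \<alpha> + \<beta> *\<^sub>R primal J)"
      unfolding x mem[symmetric] T using k \<beta> by simp
  qed
qed

lemma slice_vanishes_on_T_iff: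
  fixes a b J :: dual_quat
  assumes J: "J \<in> unit_sphere"
  shows "(\<forall>K\<in>unit_sphere. primal K = primal J \<longrightarrow> a + K * b = 0) \<longleftrightarrow>
    a + J * b = 0 \<and> primal a = 0 \<and> primal b = 0"
proof (intro iffI conjI)
  assume *: "\<forall>K\<in>unit_sphere. primal K = primal J \<longrightarrow> a + K * b = 0"
  then show aJ: "a + J * b = 0"
    using J by blast
  have J1: "primal J \<in> unit_sphere"
    using J Dual_in_unit_sphere_iff[of "primal J" "eps_part J"] by simp
  obtain k where k: "k \<in> imag_quats" "k \<noteq> 0" "quat_perp k (primal J)"
    using nonzero_imag_perp_exists[OF quat_imag_slice_point(1)[OF J1]] by blast
  have "quat_perp 0 (primal J)" "0 \<in> imag_quats"
    by (simp add: quat_perp_def, simp add: imag_quats_def zero_quat_def)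
  then have "a + Dual (primal J) 0 * b = 0" "a + Dual (primal J) k * b = 0"
    using * k J1 Dual_in_unit_sphere_iff by auto
  then have "Dual (primal J) 0 * b = Dual (primal J) k * b"
    by (metis add_left_imp_eq)
  then have "k * primal b = 0"
    by (simp add: times_dual_number_def)
  then show b: "primal b = 0"
    using k quat_mult_eq_0 by blast
  show "primal a = 0"
    using arg_cong[OF aJ, of primal] b by (simp add: dual_ops_defs)
next
  assume *: "a + J * b = 0 \<and> primal a = 0 \<and> primal b = 0"
  show "\<forall>K\<in>unit_sphere. primal K = primal J \<longrightarrow> a + K * b = 0"
  proof (intro ballI impI)
    fix K assume "primal K = primal J"
    then have "K * b = J * b"
      using * by (simp add: times_dual_number_def)
    then show "a + K * b = 0"
      using * by simp
  qed
qed

text \<open>The two points J and -J already suffice.\<close>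

lemma slice_vanishes_on_sphere_iff:
  fixes a b J :: "'a::star_algebra"
  assumes J: "J \<in> unit_sphere"
  shows "(\<forall>K\<in>unit_sphere. a + K * b = 0) \<longleftrightarrow> a = 0 \<and> b = 0"
proof
  assume *: "\<forall>K\<in>unit_sphere. a + K * b = 0"
  then have 1: "a + J * b = 0" and 2: "a + - J * b = 0"
    using J unit_sphere_uminus[OF J] by blast+
  then have "J * b = - (J * b)"
    by (metis add_left_imp_eq mult_minus_left)
  then have Jb: "J * b = 0"
    by (rule eq_uminus_imp_zero)
  have "b = - (J * (J * b))"
    by (simp add: mult.assoc[symmetric] unit_sphere_square[OF J])
  then show "a = 0 \<and> b = 0"
    using 1 Jb by simp
qed simp

text \<open>Another representation of the same point can change \<beta> only by a sign, which the
  symmetry of the unit sphere absorbs.\<close>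

lemma sphere_of_slice_point:
  assumes J: "J \<in> unit_sphere"
  shows "sphere_of (of_real \<alpha> + \<beta> *\<^sub>R J) = {of_real \<alpha> + \<beta> *\<^sub>R K | K. K \<in> unit_sphere}"
proof (intro equalityI subsetI)
  fix x assume "x \<in> sphere_of (of_real \<alpha> + \<beta> *\<^sub>R J)"
  then obtain \<alpha>' \<beta>' J' K where J': "J' \<in> unit_sphere" and K: "K \<in> unit_sphere"
    and eq: "of_real \<alpha> + \<beta> *\<^sub>R J = of_real \<alpha>' + \<beta>' *\<^sub>R J'" and x: "x = of_real \<alpha>' + \<beta>' *\<^sub>R K"
    unfolding sphere_of_def by blast
  have "\<alpha>' = \<alpha>" "\<beta>' = \<beta> \<or> \<beta>' = - \<beta>"
    using sphere_representation_unique[OF J J' eq] by blast+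
  then have "x = of_real \<alpha> + \<beta> *\<^sub>R K \<or> x = of_real \<alpha> + \<beta> *\<^sub>R (- K)"
    using x by auto
  then show "x \<in> {of_real \<alpha> + \<beta> *\<^sub>R K | K. K \<in> unit_sphere}"
    using K unit_sphere_uminus[OF K] by blast
next
  fix x :: dual_quat assume "x \<in> {of_real \<alpha> + \<beta> *\<^sub>R K | K. K \<in> unit_sphere}"
  then show "x \<in> sphere_of (of_real \<alpha> + \<beta> *\<^sub>R J)"
    unfolding sphere_of_def using J by blast
qed

theorem theorem7p6:
  fixes D :: "complex set" and f :: "dual_quat \<Rightarrow> dual_quat" and y :: dual_quat
  assumes "open D" and "\<forall>z\<in>D. cnj z \<in> D"
    and "f \<in> slice_regular D" and "y \<in> Omega D"
  shows "(y \<in> zero_set D f \<longleftrightarrow> slice_dvd D (\<lambda>x. x - y) f)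
    \<and> (y \<in> zero_set D f \<longrightarrow> slice_dvd D (\<lambda>x. x\<^sup>2 - x * tr y + nm y) (slice_norm D f))
    \<and> (y \<notin> \<real> \<longrightarrow>
        (T_set (primal y) \<subseteq> zero_set D f \<longleftrightarrow>
           slice_dvd D (\<lambda>x. x - y) f \<and>
           slice_dvd D (\<lambda>x\<^sub>1. x\<^sub>1\<^sup>2 - x\<^sub>1 * primal (tr y) + primal (nm y)) (slice_primal D f))
      \<and> (sphere_of y \<subseteq> zero_set D f \<longleftrightarrow>
           slice_dvd D (\<lambda>x. x\<^sup>2 - x * tr y + nm y) f))"
proof -
  note ne = unit_sphere_dual_quat_nonempty
  note D = \<open>\<forall>z\<in>D. cnj z \<in> D\<close>
  from \<open>f \<in> slice_regular D\<close> obtain F where F: "induced_by D f F"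
    by (auto simp: slice_regular_def)
  from \<open>y \<in> Omega D\<close> obtain \<alpha> \<beta> J where y: "y = of_real \<alpha> + \<beta> *\<^sub>R J" and w: "Complex \<alpha> \<beta> \<in> D"
    and J: "J \<in> unit_sphere"
    unfolding Omega_def by blast
  have tr_y: "tr y = of_real (2 * \<alpha>)" and nm_y: "nm y = of_real (\<alpha>\<^sup>2 + \<beta>\<^sup>2)"
    unfolding y by (rule tr_slice_point[OF J] nm_slice_point[OF J])+
  define a b where "a = part1 (F (Complex \<alpha> \<beta>))" and "b = part2 (F (Complex \<alpha> \<beta>))"
  have zero: "of_real \<alpha> + \<beta> *\<^sub>R K \<in> zero_set D f \<longleftrightarrow> a + K * b = 0" if "K \<in> unit_sphere" for K
  proof -
    have "of_real \<alpha> + \<beta> *\<^sub>R K \<in> Omega D"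
      unfolding Omega_def using w that by blast
    then show ?thesis
      using F slice_fun_eq[of D F \<alpha> \<beta> K] w that
      by (simp add: zero_set_def induced_by_def a_def b_def)
  qed
  have lin: "y \<in> zero_set D f \<longleftrightarrow> slice_dvd D (\<lambda>x. x - y) f"
    using dvd_linear_iff[OF D w F J y] \<open>y \<in> Omega D\<close> by (simp add: zero_set_def)
  have norm: "slice_dvd D (\<lambda>x. x\<^sup>2 - x * tr y + nm y) (slice_norm D f)" if "y \<in> zero_set D f"
    using dvd_slice_norm[OF D F \<open>y \<in> Omega D\<close>] lin that by blast
  have quad: "slice_dvd D (\<lambda>x. x\<^sup>2 - x * tr y + nm y) f \<longleftrightarrow> a = 0 \<and> b = 0"
    using dvd_real_quadratic_iff[OF ne D w F]
    by (simp add: tr_y nm_y a_def b_def complexified_eq_0_iff)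
  have sphere: "sphere_of y \<subseteq> zero_set D f \<longleftrightarrow> slice_dvd D (\<lambda>x. x\<^sup>2 - x * tr y + nm y) f"
    unfolding quad slice_vanishes_on_sphere_iff[OF J, symmetric]
    unfolding y sphere_of_slice_point[OF J] using zero by blast
  \<comment> \<open>The trace and norm of \<open>y\<close> are real, so their primal parts are the
    same reals viewed as quaternions, and the quaternionic instance of the quadratic criterion
    applies.\<close>
  have primal: "slice_dvd D (\<lambda>x\<^sub>1. x\<^sub>1\<^sup>2 - x\<^sub>1 * primal (tr y) + primal (nm y)) (slice_primal D f)
      \<longleftrightarrow> primal a = 0 \<and> primal b = 0"
    using dvd_real_quadratic_iff[OF unit_sphere_quat_nonempty D w induced_by_slice_primal[OF D F]]
    unfolding tr_y nm_y dual_of_real dual_number.sel by (simp add: a_def b_def complexified_eq_0_iff)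
  have T: "T_set (primal y) \<subseteq> zero_set D f \<longleftrightarrow> slice_dvd D (\<lambda>x. x - y) f \<and>
      slice_dvd D (\<lambda>x\<^sub>1. x\<^sub>1\<^sup>2 - x\<^sub>1 * primal (tr y) + primal (nm y)) (slice_primal D f)"
    if "y \<notin> \<real>"
  proof -
    have \<beta>: "\<beta> \<noteq> 0"
      using that by (auto simp: y)
    have "T_set (primal y) \<subseteq> zero_set D f \<longleftrightarrow>
        (\<forall>K\<in>unit_sphere. primal K = primal J \<longrightarrow> a + K * b = 0)"
      unfolding y T_set_slice_point[OF J \<beta>] using zero by blast
    also have "\<dots> \<longleftrightarrow> y \<in> zero_set D f \<and> primal a = 0 \<and> primal b = 0"
      unfolding slice_vanishes_on_T_iff[OF J] using zero[OF J] y by simp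
    finally show ?thesis
      unfolding lin primal .
  qed
  show ?thesis
    using lin norm T sphere by blast
qed

end
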